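(* Let $(\mathcal{X},\mathcal{U})$ be a measurable space with $\mathcal{U}$ countably generated, let $(\Omega,\mathcal{B})=(\mathcal{X}^\infty,\mathcal{U}^\infty)$ be the countably infinite product measurable space, and let $P$ be a perfect probability measure on $\mathcal{B}$. For $n\geq 1$ let $F_n$ be the group of permutations of order $n$, that is, of all maps $f:\Omega\rightarrow\Omega$ of the form $$f(\omega)=(\omega_{\pi_1},\ldots,\omega_{\pi_n},\omega_{n+1},\omega_{n+2},\ldots),\qquad \omega=(\omega_1,\omega_2,\ldots)\in\Omega,$$ for some permutation $(\pi_1,\ldots,\pi_n)$ of $(1,\ldots,n)$. Let $$\mathcal{A}=\Bigl\{B\in\mathcal{B}:f^{-1}B=B\text{ for all }f\in\bigcup_{n\geq 1}F_n\Bigr\}$$ be the symmetric $\sigma$-field, and let $\mu$ be a regular conditional distribution for $P$ given $\mathcal{A}$. Then there is a set $A_0\in\mathcal{A}$ such that $P(A_0)=1$ and $\mu(\omega)(A)\in\{0,1\}$ for all $A\in\mathcal{A}$ and $\omega\in A_0$.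
   Context: A regular conditional distribution for $P$ given a sub-$\sigma$-field $\mathcal{G}\subset\mathcal{B}$ is a map $\nu$ from $\Omega$ to the set of probability measures on $\mathcal{B}$ such that, for every $B\in\mathcal{B}$, the function $\omega\mapsto\nu(\omega)(B)$ is a version of $E(I_B\mid\mathcal{G})$ (in particular it is $\mathcal{G}$-measurable). A $\sigma$-field is countably generated if it is generated by one of its countable subclasses. A probability measure $P$ on $\mathcal{B}$ is perfect if for each $\mathcal{B}$-measurable function $f:\Omega\rightarrow\mathbb{R}$ there is a real Borel set $I\subset f(\Omega)$ with $P(f\in I)=1$. It is a known fact that, if $P$ is perfect and $\mathcal{B}$ is countably generated, then $P$ admits a regular conditional distribution given $\mathcal{G}$ for every sub-$\sigma$-field $\mathcal{G}\subset\mathcal{B}$. *)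

theory Defs
  imports "HOL-Probability.Probability" "HOL-Combinatorics.Permutations"
begin

definition countably_generated :: "'a measure \<Rightarrow> bool" where
  "countably_generated M \<longleftrightarrow>
     (\<exists>C. countable C \<and> C \<subseteq> sets M \<and> sets M = sigma_sets (space M) C)"

definition perfect_measure :: "'a measure \<Rightarrow> bool" where
  "perfect_measure P \<longleftrightarrow>
     (\<forall>f \<in> P \<rightarrow>\<^sub>M (borel :: real measure).
        \<exists>I \<in> sets borel. I \<subseteq> f ` space P \<and> measure P (f -` I \<inter> space P) = 1)"

text \<open>
  A sub-\<open>\<sigma>\<close>-field is represented by a measure \<open>G\<close> of which only the space and the measurable
  sets matter. The kernel \<open>\<nu>\<close> is a total function; its values outside \<^term>\<open>space P\<close> are
  irrelevant.
\<close>

definition regular_cond_distribution ::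
    "'a measure \<Rightarrow> 'a measure \<Rightarrow> ('a \<Rightarrow> 'a measure) \<Rightarrow> bool" where
  "regular_cond_distribution P G \<nu> \<longleftrightarrow>
     subalgebra P G \<and>
     (\<forall>\<omega> \<in> space P. prob_space (\<nu> \<omega>) \<and> sets (\<nu> \<omega>) = sets P) \<and>
     (\<forall>B \<in> sets P.
        (\<lambda>\<omega>. measure (\<nu> \<omega>) B) \<in> borel_measurable G \<and>
        (AE \<omega> in P. measure (\<nu> \<omega>) B = real_cond_exp P G (indicator B) \<omega>))"

abbreviation seq_space :: "'a measure \<Rightarrow> (nat \<Rightarrow> 'a) measure" where
  "seq_space U \<equiv> \<Pi>\<^sub>M i\<in>UNIV. U"

text \<open>Coordinates are numbered from 0, so the first \<open>n\<close> of them have indices in \<^term>\<open>{..<n}\<close>.\<close>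

definition coord_perms :: "nat \<Rightarrow> ((nat \<Rightarrow> 'a) \<Rightarrow> (nat \<Rightarrow> 'a)) set" where
  "coord_perms n = {(\<lambda>\<omega> i. \<omega> (\<pi> i)) | \<pi>. \<pi> permutes {..<n}}"

definition symmetric_sets :: "'a measure \<Rightarrow> (nat \<Rightarrow> 'a) set set" where
  "symmetric_sets U =
     {B \<in> sets (seq_space U).
        \<forall>f \<in> (\<Union>n\<in>{1..}. coord_perms n). f -` B \<inter> space (seq_space U) = B}"

definition symmetric_field :: "'a measure \<Rightarrow> (nat \<Rightarrow> 'a) measure" where
  "symmetric_field U = sigma (space (seq_space U)) (symmetric_sets U)"

lemma coord_perms_space:
  assumes "f \<in> coord_perms n" "\<omega> \<in> space (seq_space U)"
  shows "f \<omega> \<in> space (seq_space U)"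
proof -
  obtain \<pi> where f: "f = (\<lambda>\<omega> i. \<omega> (\<pi> i))"
    using assms(1) unfolding coord_perms_def mem_Collect_eq by (elim exE conjE)
  show ?thesis
    using assms(2) unfolding f by (simp add: space_PiM PiE_iff)
qed

lemma symmetric_sets_iff:
  "B \<in> symmetric_sets U \<longleftrightarrow>
     B \<in> sets (seq_space U) \<and>
     (\<forall>n\<ge>1. \<forall>f \<in> coord_perms n. \<forall>\<omega> \<in> space (seq_space U). f \<omega> \<in> B \<longleftrightarrow> \<omega> \<in> B)"
proof (cases "B \<in> sets (seq_space U)")
  case True
  then have sub: "B \<subseteq> space (seq_space U)"
    by (rule sets.sets_into_space)
  have "f -` B \<inter> \<Omega> = B \<longleftrightarrow> (\<forall>\<omega> \<in> \<Omega>. f \<omega> \<in> B \<longleftrightarrow> \<omega> \<in> B)"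
    if "B \<subseteq> \<Omega>" for f and \<Omega> :: "(nat \<Rightarrow> 'a) set"
    using that by blast
  from this[OF sub] show ?thesis
    unfolding symmetric_sets_def by (simp add: True Ball_def[of "{Suc 0..}"])
next
  case False
  then show ?thesis
    unfolding symmetric_sets_def by simp
qed

lemma sigma_algebra_symmetric_sets:
  "sigma_algebra (space (seq_space U)) (symmetric_sets U)"
  unfolding sigma_algebra_iff2
proof (intro conjI ballI allI impI)
  show "symmetric_sets U \<subseteq> Pow (space (seq_space U))"
    by (intro subsetI PowI sets.sets_into_space) (simp only: symmetric_sets_iff)
  show "{} \<in> symmetric_sets U"
    unfolding symmetric_sets_iff by simp
next
  fix B assume B: "B \<in> symmetric_sets U"
  have "f \<omega> \<in> space (seq_space U) - B \<longleftrightarrow> \<omega> \<in> space (seq_space U) - B"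
    if "n \<ge> 1" "f \<in> coord_perms n" "\<omega> \<in> space (seq_space U)" for n f \<omega>
  proof -
    have "f \<omega> \<in> B \<longleftrightarrow> \<omega> \<in> B"
      using B that unfolding symmetric_sets_iff by simp
    then show ?thesis
      using that(3) coord_perms_space[OF that(2,3)] by simp
  qed
  moreover have "space (seq_space U) - B \<in> sets (seq_space U)"
    using B unfolding symmetric_sets_iff by (intro sets.compl_sets) (elim conjE)
  ultimately show "space (seq_space U) - B \<in> symmetric_sets U"
    unfolding symmetric_sets_iff by simp
next
  fix A :: "nat \<Rightarrow> (nat \<Rightarrow> 'a) set" assume "range A \<subseteq> symmetric_sets U"
  then have A: "A i \<in> symmetric_sets U" for i
    by (simp only: image_subset_iff UNIV_I ball_simps simp_thms)
  then have "A i \<in> sets (seq_space U)" for i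
    by (simp only: symmetric_sets_iff)
  then have "(\<Union>i. A i) \<in> sets (seq_space U)"
    by (intro sets.countable_UN image_subsetI)
  with A show "(\<Union>i. A i) \<in> symmetric_sets U"
    by (simp only: symmetric_sets_iff UN_iff) simp
qed

lemma space_symmetric_field: "space (symmetric_field U) = space (seq_space U)"
  unfolding symmetric_field_def by (simp add: space_measure_of_conv)

lemma sets_symmetric_field: "sets (symmetric_field U) = symmetric_sets U"
  unfolding symmetric_field_def
  by (rule sigma_algebra.sets_measure_of_eq[OF sigma_algebra_symmetric_sets])

lemma subalgebra_symmetric_field:
  assumes "sets P = sets (seq_space U)"
  shows "subalgebra P (symmetric_field U)"
proof -
  have "symmetric_sets U \<subseteq> sets (seq_space U)"
    unfolding symmetric_sets_def by (rule Collect_restrict)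
  then show ?thesis
    unfolding subalgebra_def space_symmetric_field sets_symmetric_field assms
    using sets_eq_imp_space_eq[OF assms] by simp
qed

end

theory Submission
  imports Defs
begin

text \<open>
  The symmetric \<open>\<sigma>\<close>-field is the decreasing intersection of the \<open>\<sigma>\<close>-fields \<open>G n\<close> of events invariant
  under the permutations of order \<open>n + 1\<close>. Each \<open>G n\<close> is countably generated, by symmetrised
  indicators. By \<open>L\<^sup>2\<close>-orthogonality, versions of \<open>E(1\<^sub>B | G n)\<close> converge almost surely along a
  subsequence to a symmetric function \<open>g\<close>.

  Fix \<open>B\<close> in a countable generating \<open>\<pi>\<close>-system. For almost every \<open>\<omega>\<close> the same versions are
  conditional probabilities of \<open>B\<close> given \<open>G n\<close> under \<open>\<mu> \<omega>\<close>, since this amounts to countably many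
  identities; they still converge to \<open>g\<close>; and \<open>g\<close> is \<open>\<mu> \<omega>\<close>-almost surely constant. Passing to the
  limit, \<open>B\<close> is \<open>\<mu> \<omega>\<close>-independent of all symmetric \<open>A\<close> simultaneously. Hence under \<open>\<mu> \<omega>\<close> every
  symmetric event is independent of itself.
\<close>

section \<open>Conditional expectations along a decreasing sequence of fields\<close>

lemma prob_space_sigma_finite_subalgebra:
  assumes "prob_space P" "subalgebra P F"
  shows "sigma_finite_subalgebra P F"
  using assms
  by (intro finite_measure_subalgebra_is_sigma_finite
      finite_measure_subalgebra.intro finite_measure_subalgebra_axioms.intro prob_space.finite_measure)

lemma real_cond_exp_indicator_bounds:
  assumes P: "prob_space P" and sub: "subalgebra P F" and B: "B \<in> sets P"
  shows "AE x in P. 0 \<le> real_cond_exp P F (indicator B) x \<and> real_cond_exp P F (indicator B) x \<le> 1"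
proof -
  note F = prob_space_sigma_finite_subalgebra[OF P sub]
  have int: "integrable P (indicator B :: 'a \<Rightarrow> real)"
    using finite_measure.emeasure_finite[OF prob_space.finite_measure[OF P], of B] B
    by (simp add: less_top)
  have "AE x in P. 0 \<le> real_cond_exp P F (indicator B) x"
    by (rule sigma_finite_subalgebra.real_cond_exp_ge_c[OF F int]) simp
  moreover have "AE x in P. real_cond_exp P F (indicator B) x \<le> 1"
    by (rule sigma_finite_subalgebra.real_cond_exp_le_c[OF F int]) (simp add: indicator_def)
  ultimately show ?thesis
    by eventually_elim simp
qed

text \<open>For \<open>m \<le> n\<close>, \<open>c n\<close> is the orthogonal projection of
  \<open>c m\<close> onto the square-integrable \<open>G n\<close>-measurable functions, so their
  squared distance is \<open>a m - a n\<close>. The squared norms \<open>a\<close> decrease and are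
  nonnegative, hence \<open>c\<close> is Cauchy in mean square and in mean, and some subsequence is
  Cauchy almost everywhere.\<close>

lemma cond_exp_decreasing_AE_Cauchy:
  fixes G :: "nat \<Rightarrow> 'a measure"
  assumes P: "prob_space P" and sub: "\<And>n. subalgebra P (G n)"
    and dec: "\<And>n. sets (G (Suc n)) \<subseteq> sets (G n)" and B[measurable]: "B \<in> sets P"
  obtains r where "strict_mono r"
    "AE x in P. Cauchy (\<lambda>i. real_cond_exp P (G (r i)) (indicator B) x)"
proof -
  interpret P: prob_space P by fact
  note G = prob_space_sigma_finite_subalgebra[OF P sub]
  define c where "c n = real_cond_exp P (G n) (indicator B)" for n
  have c_P[measurable]: "c n \<in> borel_measurable P" for n
    unfolding c_def by (rule borel_measurable_cond_exp2)
  have c_G: "c n \<in> borel_measurable (G m)" if "m \<le> n" for m n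
  proof (rule measurable_from_subalg)
    show "subalgebra (G m) (G n)"
      using lift_Suc_antimono_le[of "\<lambda>n. sets (G n)", OF dec that] sub
      by (simp add: subalgebra_def)
  qed (simp add: c_def)
  have c_bd: "AE x in P. \<bar>c n x\<bar> \<le> 1" for n
    using real_cond_exp_indicator_bounds[OF P sub[of n] B] unfolding c_def
    by eventually_elim simp
  have int_c: "integrable P (c n)" for n
    using c_bd by (intro P.integrable_const_bound[where B = 1]) auto
  have int_cc: "integrable P (\<lambda>x. c m x * c n x)" for m n
  proof (rule P.integrable_const_bound[where B = 1])
    show "AE x in P. norm (c m x * c n x) \<le> 1"
      using c_bd[of m] c_bd[of n]
      by eventually_elim (auto simp: abs_mult intro!: mult_le_one)
  qed simp
  have int_cB: "integrable P (\<lambda>x. c n x * indicator B x)" for n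
    using integrable_mult_indicator[OF B int_c[of n]] by (simp add: mult.commute)
  define a where "a n = (\<integral>x. c n x * c n x \<partial>P)" for n
  \<comment> \<open>Both sides equal the integral of \<open>c n\<close> over \<open>B\<close>:
    \<open>c n\<close> is measurable for \<open>G m\<close> as well as for \<open>G n\<close>, so it
    can serve as test function for \<open>c m\<close> and for \<open>c n\<close>.\<close>
  have cross: "(\<integral>x. c n x * c m x \<partial>P) = a n" if "m \<le> n" for m n
    using sigma_finite_subalgebra.real_cond_exp_intg(2)[OF G int_cB c_G[OF that]]
      sigma_finite_subalgebra.real_cond_exp_intg(2)[OF G int_cB c_G[OF order_refl[of n]]]
    by (simp add: a_def c_def)
  have int_sq: "integrable P (\<lambda>x. (c m x - c n x)\<^sup>2)" for m n
    using int_cc by (simp add: power2_eq_square algebra_simps)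
  have dist: "(\<integral>x. (c m x - c n x)\<^sup>2 \<partial>P) = a m - a n" if "m \<le> n" for m n
  proof -
    have "(\<integral>x. (c m x - c n x)\<^sup>2 \<partial>P) = (\<integral>x. c m x * c m x - 2 * (c n x * c m x) + c n x * c n x \<partial>P)"
      by (rule Bochner_Integration.integral_cong) (auto simp: power2_eq_square algebra_simps)
    also have "\<dots> = a m - 2 * a n + a n"
      using int_cc by (simp add: cross[OF that] flip: a_def)
    finally show ?thesis by simp
  qed
  have "decseq a"
  proof (rule decseq_SucI)
    fix n
    have "0 \<le> (\<integral>x. (c n x - c (Suc n) x)\<^sup>2 \<partial>P)" by simp
    then show "a (Suc n) \<le> a n" using dist[of n "Suc n"] by simp
  qed
  moreover have "0 \<le> a n" for n unfolding a_def by simp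
  ultimately obtain l where "a \<longlonglongrightarrow> l"
    using decseq_convergent[of a 0] by blast
  then have "Cauchy a" by (rule LIMSEQ_imp_Cauchy)
  \<comment> \<open>The square of a mean is at most the mean of the square, obtained here from the
    nonnegativity of the variance.\<close>
  have L1: "(\<integral>x. norm (c m x - c n x) \<partial>P)\<^sup>2 \<le> \<bar>a m - a n\<bar>" for m n
  proof -
    have "0 \<le> P.variance (\<lambda>x. norm (c m x - c n x))"
      by (rule P.variance_positive)
    then have "(\<integral>x. norm (c m x - c n x) \<partial>P)\<^sup>2 \<le> (\<integral>x. (c m x - c n x)\<^sup>2 \<partial>P)"
      using int_c int_sq by (subst (asm) P.variance_eq) auto
    also have "\<dots> \<le> \<bar>a m - a n\<bar>"
      using dist[of m n] dist[of n m] by (cases "m \<le> n") (auto simp: power2_commute[of "c m _"])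
    finally show ?thesis .
  qed
  have "\<exists>N. \<forall>i\<ge>N. \<forall>j\<ge>N. (\<integral>x. norm (c i x - c j x) \<partial>P) < e" if "e > 0" for e
  proof -
    obtain N where N: "\<And>i j. i \<ge> N \<Longrightarrow> j \<ge> N \<Longrightarrow> \<bar>a i - a j\<bar> < e\<^sup>2"
      using \<open>Cauchy a\<close> \<open>e > 0\<close> by (auto simp: Cauchy_def dist_real_def dest!: spec[of _ "e\<^sup>2"])
    have "(\<integral>x. norm (c i x - c j x) \<partial>P) < e" if "i \<ge> N" "j \<ge> N" for i j
      using L1[of i j] N[OF that] \<open>e > 0\<close> by (intro power2_less_imp_less[of _ e]) auto
    then show ?thesis by blast
  qed
  then obtain r where "strict_mono r" "AE x in P. Cauchy (\<lambda>i. c (r i) x)"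
    using cauchy_L1_AE_cauchy_subseq[of P c, OF int_c] by blast
  then show thesis
    unfolding c_def by (rule that)
qed

text \<open>The versions \<open>h i\<close> are bounded everywhere and not just
  \<open>P\<close>-almost everywhere, because they will later be integrated against the measures
  \<open>\<mu> \<omega>\<close>. The limit depends only on the tail of the sequence, so it is
  measurable for every \<open>G n\<close> and hence for \<open>F\<close>.\<close>

lemma cond_exp_decreasing_AE_tendsto:
  fixes G :: "nat \<Rightarrow> 'a measure"
  assumes P: "prob_space P" and sub: "\<And>n. subalgebra P (G n)"
    and dec: "\<And>n. sets (G (Suc n)) \<subseteq> sets (G n)"
    and F: "space F = space P" "sets F = (\<Inter>n. sets (G n))" and B[measurable]: "B \<in> sets P"
  obtains r :: "nat \<Rightarrow> nat" and h :: "nat \<Rightarrow> 'a \<Rightarrow> real" and g :: "'a \<Rightarrow> real"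
  where "\<And>i. h i \<in> borel_measurable (G (r i))" "\<And>i x. 0 \<le> h i x" "\<And>i x. h i x \<le> 1"
    "\<And>i D. D \<in> sets (G (r i)) \<Longrightarrow>
      (\<integral>\<^sup>+x. ennreal (h i x) * indicator D x \<partial>P) = emeasure P (D \<inter> B)"
    "g \<in> borel_measurable F" "AE x in P. (\<lambda>i. h i x) \<longlonglongrightarrow> g x"
proof -
  interpret P: prob_space P by fact
  note G = prob_space_sigma_finite_subalgebra[OF P sub]
  define c where "c n = real_cond_exp P (G n) (indicator B)" for n
  obtain r where r: "strict_mono r" "AE x in P. Cauchy (\<lambda>i. c (r i) x)"
    using cond_exp_decreasing_AE_Cauchy[where G = G, OF P sub dec B] unfolding c_def by blast
  \<comment> \<open>Clipping to the unit interval changes the conditional expectation only on a null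
    set and preserves its measurability.\<close>
  define h where "h i x = max 0 (min 1 (c (r i) x))" for i x
  define g where "g x = lim (\<lambda>i. h i x)" for x
  have h01: "0 \<le> h i x" "h i x \<le> 1" for i x
    unfolding h_def by simp_all
  have c_G[measurable]: "c n \<in> borel_measurable (G n)" for n
    unfolding c_def by (rule borel_measurable_cond_exp)
  have h_G: "h i \<in> borel_measurable (G (r i))" for i
    unfolding h_def by measurable
  have hc: "AE x in P. h i x = c (r i) x" for i
    using real_cond_exp_indicator_bounds[OF P sub[of "r i"] B] unfolding c_def h_def
    by eventually_elim simp
  have g_G: "g \<in> borel_measurable (G n)" for n
  proof -
    \<comment> \<open>\<open>lim\<close> ignores the first \<open>n\<close> terms, even for divergent sequences, and \<open>n \<le> r (i + n)\<close>.\<close>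
    have "g x = lim (\<lambda>i. h (i + n) x)" for x
      unfolding g_def lim_def
      by (intro arg_cong[where f = The] ext iffI)
        (erule LIMSEQ_ignore_initial_segment, erule LIMSEQ_offset)
    moreover have "h (i + n) \<in> borel_measurable (G n)" for i
    proof (rule measurable_from_subalg[OF _ h_G])
      have "n \<le> r (i + n)"
        using seq_suble[OF r(1), of "i + n"] by simp
      then show "subalgebra (G n) (G (r (i + n)))"
        using lift_Suc_antimono_le[of "\<lambda>n. sets (G n)", OF dec] sub
        by (simp add: subalgebra_def)
    qed
    ultimately show ?thesis
      by (simp add: borel_measurable_lim_metric cong: measurable_cong)
  qed
  have g_F: "g \<in> borel_measurable F"
  proof (rule measurableI)
    fix A :: "real set" assume "A \<in> sets borel"
    then have "g -` A \<inter> space P \<in> sets (G n)" for n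
      using measurable_sets[OF g_G[of n], of A] sub[of n] by (simp add: subalgebra_def)
    then show "g -` A \<inter> space F \<in> sets F"
      by (simp add: F)
  qed simp
  have h_lim: "AE x in P. (\<lambda>i. h i x) \<longlonglongrightarrow> g x"
  proof -
    have "AE x in P. \<forall>i. h i x = c (r i) x"
      using hc by (simp add: AE_all_countable)
    with r(2) show ?thesis
    proof eventually_elim
      case (elim x)
      then have "Cauchy (\<lambda>i. h i x)" by simp
      then show ?case
        unfolding g_def by (simp add: Cauchy_convergent_iff convergent_LIMSEQ_iff)
    qed
  qed
  have h_D: "(\<integral>\<^sup>+x. ennreal (h i x) * indicator D x \<partial>P) = emeasure P (D \<inter> B)"
    if D: "D \<in> sets (G (r i))" for i D
  proof -
    have D_P[measurable]: "D \<in> sets P"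
      using D sub by (auto simp: subalgebra_def)
    have h_P[measurable]: "h i \<in> borel_measurable P"
      by (rule measurable_from_subalg[OF sub h_G])
    have int_DB: "integrable P (\<lambda>x. indicator D x * indicator B x :: real)"
      by (rule P.integrable_const_bound[where B = 1]) (auto simp: indicator_def)
    have int_hD: "integrable P (\<lambda>x. indicator D x * h i x)"
    proof (rule P.integrable_const_bound[where B = 1])
      show "AE x in P. norm (indicator D x * h i x) \<le> 1"
        by (intro AE_I2) (simp add: indicator_def abs_of_nonneg h01)
      show "(\<lambda>x. indicator D x * h i x) \<in> borel_measurable P"
        by (intro borel_measurable_times borel_measurable_indicator D_P h_P)
    qed
    have "(\<integral>\<^sup>+x. ennreal (h i x) * indicator D x \<partial>P) = (\<integral>\<^sup>+x. ennreal (indicator D x * h i x) \<partial>P)"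
      by (intro nn_integral_cong) (auto simp: indicator_def)
    also have "\<dots> = ennreal (\<integral>x. indicator D x * h i x \<partial>P)"
      by (intro nn_integral_eq_integral int_hD) (auto simp: h01)
    also have "(\<integral>x. indicator D x * h i x \<partial>P) = (\<integral>x. indicator D x * c (r i) x \<partial>P)"
      using hc[of i] by (intro integral_cong_AE) (auto simp: c_def)
    also have "\<dots> = (\<integral>x. indicator D x * indicator B x \<partial>P)"
      unfolding c_def using D by (intro sigma_finite_subalgebra.real_cond_exp_intg[OF G] int_DB) auto
    also have "\<dots> = measure P (D \<inter> B)"
      by (simp flip: indicator_inter_arith)
    finally show ?thesis
      by (simp add: P.emeasure_eq_measure)
  qed
  show thesis
    by (rule that[OF h_G _ _ h_D g_F h_lim]) (auto simp: h01)
qed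

section \<open>Countable generators and uniqueness of measures\<close>

lemma countably_generated_Int_stable:
  assumes "countably_generated M"
  obtains E where "countable E" "Int_stable E" "E \<subseteq> sets M" "space M \<in> E"
    "sets M = sigma_sets (space M) E"
proof -
  obtain C where C: "countable C" "C \<subseteq> sets M" "sets M = sigma_sets (space M) C"
    using assms unfolding countably_generated_def by blast
  \<comment> \<open>A countable set has only countably many finite subsets. The factor
    \<open>space M\<close> makes the empty family yield \<open>space M\<close> rather than the whole
    type.\<close>
  define E where "E = (\<lambda>A. space M \<inter> \<Inter>A) ` {A. finite A \<and> A \<subseteq> C}"
  have "countable E"
    unfolding E_def by (intro countable_image countable_Collect_finite_subset C)
  moreover have "Int_stable E"
    unfolding E_def
  proof (rule Int_stableI_image)
    fix A B assume "A \<in> {A. finite A \<and> A \<subseteq> C}" "B \<in> {A. finite A \<and> A \<subseteq> C}"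
    then show "\<exists>D\<in>{A. finite A \<and> A \<subseteq> C}.
        (space M \<inter> \<Inter>A) \<inter> (space M \<inter> \<Inter>B) = space M \<inter> \<Inter>D"
      by (intro bexI[of _ "A \<union> B"]) auto
  qed
  moreover have E_sub: "E \<subseteq> sets M"
  proof
    fix X assume "X \<in> E"
    then obtain A where A: "finite A" "A \<subseteq> C" "X = space M \<inter> \<Inter>A"
      unfolding E_def by blast
    have "space M \<inter> \<Inter>A \<in> sets M"
      using A(1,2)
    proof (induction A rule: finite_induct)
      case (insert B A)
      then have "B \<inter> (space M \<inter> \<Inter>A) \<in> sets M"
        using C(2) by blast
      then show ?case by (simp add: Int_left_commute)
    qed simp
    with A show "X \<in> sets M" by simp
  qed
  moreover have "space M \<in> E"
    unfolding E_def by (rule image_eqI[of _ _ "{}"]) auto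
  moreover have "C \<subseteq> E"
  proof
    fix X assume X: "X \<in> C"
    then have "X = space M \<inter> \<Inter>{X}"
      using sets.sets_into_space C(2) by auto
    with X show "X \<in> E" unfolding E_def by blast
  qed
  then have "sets M = sigma_sets (space M) E"
    using C(3) sigma_sets_mono'[of C E "space M"] sets.sigma_sets_subset[OF E_sub] by auto
  ultimately show thesis by (rule that)
qed

text \<open>\<open>E\<close> may generate only a proper subfield of \<open>sets M\<close>, so both
  measures are first restricted to the field that \<open>E\<close> generates; there the usual
  uniqueness theorem applies.\<close>

lemma emeasure_eq_on_sigma_sets:
  assumes "Int_stable E" "E \<subseteq> sets M" "sets N = sets M" "space M \<in> E"
    and eq: "\<And>X. X \<in> E \<Longrightarrow> emeasure M X = emeasure N X"
    and fin: "emeasure M (space M) \<noteq> \<infinity>"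
    and X: "X \<in> sigma_sets (space M) E"
  shows "emeasure M X = emeasure N X"
proof -
  let ?S = "sigma (space M) E"
  have E: "E \<subseteq> Pow (space M)"
    using assms(2) sets.sets_into_space by blast
  have S: "sets ?S = sigma_sets (space M) E"
    using E by simp
  have sp: "space N = space M"
    using assms(3) by (rule sets_eq_imp_space_eq)
  have sub: "subalgebra M ?S" "subalgebra N ?S"
    unfolding subalgebra_def S assms(3)
    using assms(2) by (auto simp: space_measure_of_conv sp intro!: sets.sigma_sets_subset)
  have "restr_to_subalg M ?S = restr_to_subalg N ?S"
  proof (rule measure_eqI_generator_eq[where A = "\<lambda>_. space M", OF assms(1) E])
    fix Y assume "Y \<in> E"
    then show "emeasure (restr_to_subalg M ?S) Y = emeasure (restr_to_subalg N ?S) Y"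
      using eq[of Y] by (simp add: emeasure_restr_to_subalg sub S sigma_sets.Basic)
  next
    show "emeasure (restr_to_subalg M ?S) (space M) \<noteq> \<infinity>"
      using fin by (simp add: emeasure_restr_to_subalg sub S sigma_sets_top)
  qed (use assms(4) sub in \<open>auto simp: sets_restr_to_subalg S\<close>)
  then have "emeasure (restr_to_subalg M ?S) X = emeasure (restr_to_subalg N ?S) X"
    by simp
  then show ?thesis
    using X by (simp add: emeasure_restr_to_subalg sub S)
qed

section \<open>Regular conditional distributions as kernels\<close>

lemma regular_cond_distributionD:
  assumes "regular_cond_distribution P F \<mu>"
  shows "subalgebra P F"
    and "\<omega> \<in> space P \<Longrightarrow> prob_space (\<mu> \<omega>)"
    and "\<omega> \<in> space P \<Longrightarrow> sets (\<mu> \<omega>) = sets P"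
    and "\<omega> \<in> space P \<Longrightarrow> space (\<mu> \<omega>) = space P"
    and "B \<in> sets P \<Longrightarrow> (\<lambda>\<omega>. measure (\<mu> \<omega>) B) \<in> borel_measurable F"
    and "B \<in> sets P \<Longrightarrow>
      AE \<omega> in P. measure (\<mu> \<omega>) B = real_cond_exp P F (indicator B) \<omega>"
  using assms unfolding regular_cond_distribution_def
  by (auto dest: sets_eq_imp_space_eq)

text \<open>Gives access to \<open>bind\<close> and its integration rules. The source is
  \<open>restr_to_subalg P F\<close> so that exceptional null sets found later belong to
  \<open>F\<close>.\<close>

lemma regular_cond_distribution_measurable:
  assumes "regular_cond_distribution P F \<mu>"
  shows "\<mu> \<in> restr_to_subalg P F \<rightarrow>\<^sub>M subprob_algebra P"
proof (rule measurable_subprob_algebra)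
  note D = regular_cond_distributionD[OF assms]
  fix \<omega> assume "\<omega> \<in> space (restr_to_subalg P F)"
  then have "\<omega> \<in> space P" by (simp add: space_restr_to_subalg)
  then show "subprob_space (\<mu> \<omega>)" "sets (\<mu> \<omega>) = sets P"
    using D by (auto intro: prob_space_imp_subprob_space)
next
  note D = regular_cond_distributionD[OF assms]
  fix B assume B: "B \<in> sets P"
  have "(\<lambda>\<omega>. ennreal (measure (\<mu> \<omega>) B)) \<in> borel_measurable (restr_to_subalg P F)"
    using measurable_in_subalg[OF D(1) D(5)[OF B]] by simp
  then show "(\<lambda>\<omega>. emeasure (\<mu> \<omega>) B) \<in> borel_measurable (restr_to_subalg P F)"
    by (rule measurable_cong[THEN iffD1, rotated])
      (use D(2) in \<open>auto simp: space_restr_to_subalg finite_measure.emeasure_eq_measure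
        prob_space.finite_measure\<close>)
qed

text \<open>Extends the defining property from indicators to nonnegative functions. Averaging the
  kernel over \<open>A\<close> gives the measure with density \<open>indicator A\<close> with
  respect to \<open>P\<close>; this is checked on events, and the integral of \<open>f\<close> then
  comes from the integration rule for \<open>bind\<close>.\<close>

lemma regular_cond_distribution_nn_integral:
  assumes P: "prob_space P" and rcd: "regular_cond_distribution P F \<mu>"
    and A: "A \<in> sets F" and f[measurable]: "f \<in> borel_measurable P"
  shows "(\<integral>\<^sup>+\<omega>. (\<integral>\<^sup>+x. f x \<partial>\<mu> \<omega>) * indicator A \<omega> \<partial>restr_to_subalg P F) =
    (\<integral>\<^sup>+x. f x * indicator A x \<partial>P)"
proof -
  note D = regular_cond_distributionD[OF rcd]
  let ?R = "restr_to_subalg P F"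
  let ?D = "density ?R (indicator A)"
  interpret P: prob_space P by fact
  note F = prob_space_sigma_finite_subalgebra[OF P D(1)]
  have A'[measurable]: "A \<in> sets P"
    using A D(1) by (auto simp: subalgebra_def)
  have A_R[measurable]: "A \<in> sets ?R"
    using A by (simp add: sets_restr_to_subalg D(1))
  have K[measurable]: "\<mu> \<in> ?R \<rightarrow>\<^sub>M subprob_algebra P"
    by (rule regular_cond_distribution_measurable[OF rcd])
  have K': "\<mu> \<in> ?D \<rightarrow>\<^sub>M subprob_algebra P"
    by simp
  have ne: "space ?D \<noteq> {}"
    using P.not_empty by (simp add: space_restr_to_subalg)
  have "?D \<bind> \<mu> = density P (indicator A)"
  proof (rule measure_eqI)
    show "sets (?D \<bind> \<mu>) = sets (density P (indicator A))"
      using sets_bind[OF sets_kernel[OF K'] ne] by simp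
    fix B assume "B \<in> sets (?D \<bind> \<mu>)"
    then have B[measurable]: "B \<in> sets P"
      using sets_bind[OF sets_kernel[OF K'] ne] by simp
    have int: "integrable P (\<lambda>\<omega>. indicator A \<omega> * indicator B \<omega> :: real)"
      by (rule P.integrable_const_bound[where B = 1]) (auto simp: indicator_def)
    have "emeasure (?D \<bind> \<mu>) B = (\<integral>\<^sup>+\<omega>. emeasure (\<mu> \<omega>) B \<partial>?D)"
      by (rule emeasure_bind[OF ne K' B])
    also have "\<dots> = (\<integral>\<^sup>+\<omega>. indicator A \<omega> * emeasure (\<mu> \<omega>) B \<partial>?R)"
      by (rule nn_integral_density) measurable
    also have "\<dots> = (\<integral>\<^sup>+\<omega>. ennreal (indicator A \<omega> * measure (\<mu> \<omega>) B) \<partial>?R)"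
      by (intro nn_integral_cong)
        (auto simp: space_restr_to_subalg finite_measure.emeasure_eq_measure
          prob_space.finite_measure D(2) indicator_def)
    also have "\<dots> = (\<integral>\<^sup>+\<omega>. ennreal (indicator A \<omega> * measure (\<mu> \<omega>) B) \<partial>P)"
      using A D(5)[OF B] by (intro nn_integral_subalgebra2[OF D(1)] measurable_compose[OF _ measurable_ennreal]
        borel_measurable_times borel_measurable_indicator)
    also have "\<dots> = (\<integral>\<^sup>+\<omega>. ennreal (indicator A \<omega> * real_cond_exp P F (indicator B) \<omega>) \<partial>P)"
      using D(6)[OF B] by (intro nn_integral_cong_AE) auto
    also have "\<dots> = ennreal (\<integral>\<omega>. indicator A \<omega> * real_cond_exp P F (indicator B) \<omega> \<partial>P)"
    proof (rule nn_integral_eq_integral)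
      show "integrable P (\<lambda>\<omega>. indicator A \<omega> * real_cond_exp P F (indicator B) \<omega>)"
        using A by (intro sigma_finite_subalgebra.real_cond_exp_intg[OF F] int) auto
      show "AE \<omega> in P. 0 \<le> indicator A \<omega> * real_cond_exp P F (indicator B) \<omega>"
        using sigma_finite_subalgebra.real_cond_exp_pos[OF F, of "indicator B"] by auto
    qed
    also have "(\<integral>\<omega>. indicator A \<omega> * real_cond_exp P F (indicator B) \<omega> \<partial>P)
        = (\<integral>\<omega>. indicator A \<omega> * indicator B \<omega> \<partial>P)"
      using A by (intro sigma_finite_subalgebra.real_cond_exp_intg[OF F] int) auto
    also have "\<dots> = measure P (A \<inter> B)"
      by (simp flip: indicator_inter_arith)
    also have "ennreal (measure P (A \<inter> B)) = emeasure (density P (indicator A)) B"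
      by (simp add: emeasure_density P.emeasure_eq_measure flip: indicator_inter_arith)
    finally show "emeasure (?D \<bind> \<mu>) B = emeasure (density P (indicator A)) B" .
  qed
  then have "(\<integral>\<^sup>+x. f x \<partial>(?D \<bind> \<mu>)) = (\<integral>\<^sup>+x. f x \<partial>density P (indicator A))"
    by simp
  moreover have "(\<integral>\<^sup>+x. f x \<partial>(?D \<bind> \<mu>)) = (\<integral>\<^sup>+\<omega>. (\<integral>\<^sup>+x. f x \<partial>\<mu> \<omega>) \<partial>?D)"
    by (rule nn_integral_bind[OF f K'])
  moreover have "(\<lambda>\<omega>. \<integral>\<^sup>+x. f x \<partial>\<mu> \<omega>) \<in> borel_measurable ?R"
    by (rule measurable_compose[OF K nn_integral_measurable_subprob_algebra[OF f]])
  ultimately show ?thesis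
    by (simp add: nn_integral_density mult.commute)
qed

text \<open>The tool for carrying an identity from \<open>P\<close> to
  \<open>\<mu> \<omega>\<close>. Both kernel integrals are \<open>F\<close>-measurable functions of
  \<open>\<omega>\<close> with the same integral over every event of \<open>F\<close>, so they agree
  almost surely.\<close>

lemma regular_cond_distribution_AE_eq:
  assumes P: "prob_space P" and rcd: "regular_cond_distribution P F \<mu>"
    and f: "f \<in> borel_measurable P" and g: "g \<in> borel_measurable P"
    and eq: "\<And>A. A \<in> sets F \<Longrightarrow> (\<integral>\<^sup>+x. f x * indicator A x \<partial>P) = (\<integral>\<^sup>+x. g x * indicator A x \<partial>P)"
  shows "AE \<omega> in restr_to_subalg P F. (\<integral>\<^sup>+x. f x \<partial>\<mu> \<omega>) = (\<integral>\<^sup>+x. g x \<partial>\<mu> \<omega>)"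
proof -
  note sub = regular_cond_distributionD(1)[OF rcd]
  note K = regular_cond_distribution_measurable[OF rcd]
  interpret R: prob_space "restr_to_subalg P F"
    by (rule prob_space_restr_to_subalg[OF sub P])
  show ?thesis
  proof (rule R.density_unique_finite_measure)
    fix A assume "A \<in> sets (restr_to_subalg P F)"
    then have "A \<in> sets F" by (simp add: sets_restr_to_subalg sub)
    then show "(\<integral>\<^sup>+\<omega>. (\<integral>\<^sup>+x. f x \<partial>\<mu> \<omega>) * indicator A \<omega> \<partial>restr_to_subalg P F) =
        (\<integral>\<^sup>+\<omega>. (\<integral>\<^sup>+x. g x \<partial>\<mu> \<omega>) * indicator A \<omega> \<partial>restr_to_subalg P F)"
      using eq by (simp add: regular_cond_distribution_nn_integral[OF P rcd] f g)
  qed (auto intro: measurable_compose[OF K nn_integral_measurable_subprob_algebra] f g)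
qed

text \<open>The exceptional set lies in a \<open>P\<close>-null set \<open>N\<close>, and comparing
  \<open>indicator N\<close> with zero shows that almost every \<open>\<mu> \<omega>\<close> gives
  \<open>N\<close> measure zero.\<close>

lemma regular_cond_distribution_AE_AE:
  assumes P: "prob_space P" and rcd: "regular_cond_distribution P F \<mu>"
    and Q: "AE x in P. Q x"
  shows "AE \<omega> in restr_to_subalg P F. AE x in \<mu> \<omega>. Q x"
proof -
  note D = regular_cond_distributionD[OF rcd]
  obtain N where N: "N \<in> null_sets P" "\<And>x. x \<in> space P - N \<Longrightarrow> Q x"
    using AE_E3[OF Q] by metis
  have "AE \<omega> in restr_to_subalg P F. (\<integral>\<^sup>+x. indicator N x \<partial>\<mu> \<omega>) = (\<integral>\<^sup>+x. 0 \<partial>\<mu> \<omega>)"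
  proof (rule regular_cond_distribution_AE_eq[OF P rcd, where f = "indicator N" and g = "\<lambda>_. 0"])
    fix A assume "A \<in> sets F"
    have "(\<integral>\<^sup>+x. indicator N x * indicator A x \<partial>P) = (\<integral>\<^sup>+x. 0 \<partial>P)"
      using AE_not_in[OF N(1)] by (intro nn_integral_cong_AE) auto
    then show "(\<integral>\<^sup>+x. indicator N x * indicator A x \<partial>P) = (\<integral>\<^sup>+x. 0 * indicator A x \<partial>P)"
      by simp
  qed (use N in auto)
  moreover have "AE \<omega> in restr_to_subalg P F. \<omega> \<in> space P"
    by (rule AE_I2) (simp add: space_restr_to_subalg)
  ultimately show ?thesis
  proof eventually_elim
    case (elim \<omega>)
    then have "N \<in> null_sets (\<mu> \<omega>)"
      using N(1) D(3)[of \<omega>] by (intro null_setsI) auto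
    from AE_not_in[OF this] AE_space show ?case
      by eventually_elim (use N(2) D(4)[OF elim(2)] in auto)
  qed
qed

text \<open>The indicator of an event in \<open>F\<close> is its own conditional expectation, so
  \<open>\<mu> \<omega>\<close> gives \<open>V\<close> mass one or zero according to whether
  \<open>\<omega>\<close> lies in \<open>V\<close>. The exceptional set depends on
  \<open>V\<close>.\<close>

lemma regular_cond_distribution_AE_mem_iff:
  assumes P: "prob_space P" and rcd: "regular_cond_distribution P F \<mu>"
    and V: "V \<in> sets F"
  shows "AE \<omega> in restr_to_subalg P F. AE x in \<mu> \<omega>. x \<in> V \<longleftrightarrow> \<omega> \<in> V"
proof -
  note D = regular_cond_distributionD[OF rcd]
  note K = regular_cond_distribution_measurable[OF rcd]
  interpret R: prob_space "restr_to_subalg P F"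
    by (rule prob_space_restr_to_subalg[OF D(1) P])
  have V'[measurable]: "V \<in> sets P"
    using V D(1) by (auto simp: subalgebra_def)
  have V_R: "V \<in> sets (restr_to_subalg P F)"
    using V by (simp add: sets_restr_to_subalg D(1))
  have "AE \<omega> in restr_to_subalg P F. (\<integral>\<^sup>+x. indicator V x \<partial>\<mu> \<omega>) = indicator V \<omega>"
  proof (rule R.density_unique_finite_measure)
    show "(\<lambda>\<omega>. \<integral>\<^sup>+x. indicator V x \<partial>\<mu> \<omega>) \<in> borel_measurable (restr_to_subalg P F)"
      by (rule measurable_compose[OF K nn_integral_measurable_subprob_algebra]) simp
    fix A assume "A \<in> sets (restr_to_subalg P F)"
    then have A: "A \<in> sets F" by (simp add: sets_restr_to_subalg D(1))
    have "(\<integral>\<^sup>+\<omega>. indicator V \<omega> * indicator A \<omega> \<partial>restr_to_subalg P F) =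
        (\<integral>\<^sup>+\<omega>. indicator V \<omega> * indicator A \<omega> \<partial>P)"
      using A V by (intro nn_integral_subalgebra2[OF D(1)] borel_measurable_times_ennreal
        borel_measurable_indicator)
    then show "(\<integral>\<^sup>+\<omega>. (\<integral>\<^sup>+x. indicator V x \<partial>\<mu> \<omega>) * indicator A \<omega> \<partial>restr_to_subalg P F) =
        (\<integral>\<^sup>+\<omega>. indicator V \<omega> * indicator A \<omega> \<partial>restr_to_subalg P F)"
      using regular_cond_distribution_nn_integral[OF P rcd A, of "indicator V"] by simp
  qed (use V_R in auto)
  moreover have "AE \<omega> in restr_to_subalg P F. \<omega> \<in> space P"
    by (rule AE_I2) (simp add: space_restr_to_subalg)
  ultimately show ?thesis
  proof eventually_elim
    case (elim \<omega>)
    interpret \<nu>: prob_space "\<mu> \<omega>"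
      by (rule D(2)[OF elim(2)])
    have [measurable]: "V \<in> sets (\<mu> \<omega>)"
      using D(3)[OF elim(2)] by simp
    have em: "emeasure (\<mu> \<omega>) V = indicator V \<omega>"
      using elim(1) by simp
    show ?case
    proof (cases "\<omega> \<in> V")
      case True
      then show ?thesis
        using \<nu>.AE_in_set_eq_1[of V] em by (simp add: \<nu>.emeasure_eq_measure)
    next
      case False
      then show ?thesis
        using em AE_not_in[of V "\<mu> \<omega>"] by (auto simp: null_sets_def)
    qed
  qed
qed

text \<open>Countably many events \<open>q < g\<close> with rational \<open>q\<close> already
  separate the values of \<open>g\<close>, so the exceptional sets of the previous lemma can be
  united.\<close>

lemma regular_cond_distribution_AE_const:
  fixes g :: "'a \<Rightarrow> real"
  assumes P: "prob_space P" and rcd: "regular_cond_distribution P F \<mu>"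
    and g: "g \<in> borel_measurable F"
  shows "AE \<omega> in restr_to_subalg P F. AE x in \<mu> \<omega>. g x = g \<omega>"
proof -
  note D = regular_cond_distributionD[OF rcd]
  have sp: "space F = space P"
    using D(1) by (simp add: subalgebra_def)
  have "AE \<omega> in restr_to_subalg P F. \<forall>q\<in>\<rat>. AE x in \<mu> \<omega>.
      x \<in> {y \<in> space F. q < g y} \<longleftrightarrow> \<omega> \<in> {y \<in> space F. q < g y}"
    using g by (intro AE_ball_countable[THEN iffD2] ballI countable_rat
        regular_cond_distribution_AE_mem_iff[OF P rcd]) measurable
  moreover have "AE \<omega> in restr_to_subalg P F. \<omega> \<in> space P"
    by (rule AE_I2) (simp add: space_restr_to_subalg)
  ultimately show ?thesis
  proof eventually_elim
    case (elim \<omega>)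
    have "AE x in \<mu> \<omega>. \<forall>q\<in>\<rat>. x \<in> {y \<in> space F. q < g y} \<longleftrightarrow> \<omega> \<in> {y \<in> space F. q < g y}"
      using elim(1) by (intro AE_ball_countable[THEN iffD2] countable_rat)
    moreover have "AE x in \<mu> \<omega>. x \<in> space P"
      by (rule AE_I2) (simp add: D(4)[OF elim(2)])
    ultimately show ?case
    proof eventually_elim
      case (elim x)
      then have "q < g x \<longleftrightarrow> q < g \<omega>" if "q \<in> \<rat>" for q
        using that \<open>\<omega> \<in> space P\<close> sp by auto
      then have "\<not> g x < g \<omega>" "\<not> g \<omega> < g x"
        using Rats_dense_in_real[of "g x" "g \<omega>"] Rats_dense_in_real[of "g \<omega>" "g x"]
        by (meson order_less_asym)+
      then show ?case by simp
    qed
  qed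
qed

section \<open>The zero-one law for a decreasing intersection\<close>

text \<open>Countable generation is assumed of \<open>P\<close> and of each \<open>G n\<close>, but
  not of their intersection \<open>F\<close>. A null set for each event of \<open>F\<close> would
  therefore not do; all null sets come from generators of the \<open>G n\<close> and of
  \<open>P\<close>, and from the convergence of versions.\<close>

lemma regular_cond_distribution_zero_one_decreasing:
  fixes G :: "nat \<Rightarrow> 'a measure"
  assumes P: "prob_space P" and cg: "countably_generated P"
    and cgG: "\<And>n. countably_generated (G n)" and sub: "\<And>n. subalgebra P (G n)"
    and dec: "\<And>n. sets (G (Suc n)) \<subseteq> sets (G n)"
    and F: "sets F = (\<Inter>n. sets (G n))"
    and rcd: "regular_cond_distribution P F \<mu>"
  shows "\<exists>A\<^sub>0\<in>sets F. measure P A\<^sub>0 = 1 \<and>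
    (\<forall>A\<in>sets F. \<forall>\<omega>\<in>A\<^sub>0. measure (\<mu> \<omega>) A \<in> {0, 1})"
proof -
  note D = regular_cond_distributionD[OF rcd]
  interpret P: prob_space P by fact
  let ?R = "restr_to_subalg P F"
  interpret R: prob_space ?R
    by (rule prob_space_restr_to_subalg[OF D(1) P])
  have sp: "space F = space P"
    using D(1) by (simp add: subalgebra_def)
  obtain E where E: "countable E" "Int_stable E" "E \<subseteq> sets P" "space P \<in> E"
      "sets P = sigma_sets (space P) E"
    using countably_generated_Int_stable[OF cg] by blast
  \<comment> \<open>The quantifier over \<open>A\<close> stands inside the almost sure statement:
    one exceptional set serves all, possibly uncountably many, events of \<open>F\<close>.\<close>
  have indep: "AE \<omega> in ?R. \<forall>A\<in>sets F.
      emeasure (\<mu> \<omega>) (A \<inter> B) = emeasure (\<mu> \<omega>) A * emeasure (\<mu> \<omega>) B"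
    if BE: "B \<in> E" for B
  proof -
    have B[measurable]: "B \<in> sets P" using BE E(3) by blast
    obtain r :: "nat \<Rightarrow> nat" and h :: "nat \<Rightarrow> 'a \<Rightarrow> real" and g :: "'a \<Rightarrow> real" where h: "\<And>i. h i \<in> borel_measurable (G (r i))"
        "\<And>i x. 0 \<le> h i x" "\<And>i x. h i x \<le> 1"
        "\<And>i D. D \<in> sets (G (r i)) \<Longrightarrow>
          (\<integral>\<^sup>+x. ennreal (h i x) * indicator D x \<partial>P) = emeasure P (D \<inter> B)"
      and g: "g \<in> borel_measurable F" and lim: "AE x in P. (\<lambda>i. h i x) \<longlonglongrightarrow> g x"
      by (rule cond_exp_decreasing_AE_tendsto[where G = G, OF P sub dec sp F B]) (rule that)
    have h_P[measurable]: "h i \<in> borel_measurable P" for i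
      by (rule measurable_from_subalg[OF sub h(1)])
    have g_P[measurable]: "g \<in> borel_measurable P"
      by (rule measurable_from_subalg[OF D(1) g])
    have "\<exists>C. countable C \<and> Int_stable C \<and> C \<subseteq> sets (G n) \<and> space P \<in> C \<and>
        sets (G n) = sigma_sets (space P) C" for n
    proof -
      have "space (G n) = space P"
        using sub[of n] by (simp add: subalgebra_def)
      then show ?thesis
        using countably_generated_Int_stable[OF cgG[of n]] by metis
    qed
    then obtain C where C: "\<And>n. countable (C n)" "\<And>n. Int_stable (C n)"
        "\<And>n. C n \<subseteq> sets (G n)" "\<And>n. space P \<in> C n"
        "\<And>n. sets (G n) = sigma_sets (space P) (C n)"
      by metis
    have C_P: "D \<in> sets P" if "D \<in> C n" for D n
      using that C(3) sub[of n] by (auto simp: subalgebra_def)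
    \<comment> \<open>A test event \<open>A\<close> of \<open>F\<close> belongs to
      \<open>G (r i)\<close>, hence so does \<open>D \<inter> A\<close>, and the defining property
      of \<open>h i\<close> under \<open>P\<close> applies to it. Only countably many pairs of
      \<open>i\<close> and \<open>D\<close> occur.\<close>
    have "AE \<omega> in ?R. (\<integral>\<^sup>+x. ennreal (h i x) * indicator D x \<partial>\<mu> \<omega>) =
        (\<integral>\<^sup>+x. indicator (D \<inter> B) x \<partial>\<mu> \<omega>)" if DC: "D \<in> C (r i)" for i D
    proof (rule regular_cond_distribution_AE_eq[OF P rcd])
      note [measurable] = C_P[OF DC]
      show "(\<lambda>x. ennreal (h i x) * indicator D x) \<in> borel_measurable P" by measurable
      show "indicator (D \<inter> B) \<in> borel_measurable P" by measurable
      fix A assume A: "A \<in> sets F"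
      then have [measurable]: "A \<in> sets P" using D(1) by (auto simp: subalgebra_def)
      have "D \<inter> A \<in> sets (G (r i))"
        using A F C(3)[of "r i"] DC by (intro sets.Int) auto
      then have "(\<integral>\<^sup>+x. ennreal (h i x) * indicator (D \<inter> A) x \<partial>P) = emeasure P (D \<inter> A \<inter> B)"
        by (rule h(4))
      also have "\<dots> = (\<integral>\<^sup>+x. indicator (D \<inter> A \<inter> B) x \<partial>P)"
        by simp
      finally show "(\<integral>\<^sup>+x. ennreal (h i x) * indicator D x * indicator A x \<partial>P) =
          (\<integral>\<^sup>+x. indicator (D \<inter> B) x * indicator A x \<partial>P)"
        by (simp add: indicator_inter_arith mult_ac)
    qed
    then have "AE \<omega> in ?R. \<forall>i. \<forall>D\<in>C (r i). (\<integral>\<^sup>+x. ennreal (h i x) * indicator D x \<partial>\<mu> \<omega>) =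
        (\<integral>\<^sup>+x. indicator (D \<inter> B) x \<partial>\<mu> \<omega>)"
      using C(1) by (simp add: AE_all_countable AE_ball_countable)
    moreover have "AE \<omega> in ?R. AE x in \<mu> \<omega>. (\<lambda>i. h i x) \<longlonglongrightarrow> g x"
      by (rule regular_cond_distribution_AE_AE[OF P rcd lim])
    moreover have "AE \<omega> in ?R. AE x in \<mu> \<omega>. g x = g \<omega>"
      by (rule regular_cond_distribution_AE_const[OF P rcd g])
    moreover have "AE \<omega> in ?R. \<omega> \<in> space P"
      by (rule AE_I2) (simp add: space_restr_to_subalg)
    ultimately show ?thesis
    proof eventually_elim
      case (elim \<omega>)
      let ?\<nu> = "\<mu> \<omega>"
      note sets_\<nu>[measurable_cong] = D(3)[OF elim(4)]
      note sp_\<nu> = D(4)[OF elim(4)]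
      interpret \<nu>: prob_space ?\<nu> by (rule D(2)[OF elim(4)])
      have h_\<nu>[measurable]: "h i \<in> borel_measurable ?\<nu>" for i by measurable
      \<comment> \<open>With \<open>\<omega>\<close> now fixed, the identity passes from the
        generators \<open>C (r i)\<close> to all of \<open>G (r i)\<close>, as equality of the
        measures with densities \<open>h i\<close> and \<open>indicator B\<close>. No further null
        set arises.\<close>
      have hG: "(\<integral>\<^sup>+x. ennreal (h i x) * indicator A x \<partial>?\<nu>) = emeasure ?\<nu> (A \<inter> B)"
        if A: "A \<in> sets (G (r i))" for i A
      proof -
        have in_P: "A \<in> sets P" if "A \<in> sets (G n)" for A n
          using that sub[of n] by (auto simp: subalgebra_def)
        have hd: "emeasure (density ?\<nu> (\<lambda>x. ennreal (h i x))) X =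
            (\<integral>\<^sup>+x. ennreal (h i x) * indicator X x \<partial>?\<nu>)" if "X \<in> sets P" for X
          using that by (intro emeasure_density) (auto simp: sets_\<nu>)
        have Bd: "emeasure (density ?\<nu> (indicator B)) X = emeasure ?\<nu> (X \<inter> B)"
          if "X \<in> sets P" for X
          using that by (subst emeasure_density)
            (auto simp: sets_\<nu> Int_commute simp flip: indicator_inter_arith)
        have "emeasure (density ?\<nu> (\<lambda>x. ennreal (h i x))) A = emeasure (density ?\<nu> (indicator B)) A"
        proof (rule emeasure_eq_on_sigma_sets[where E = "C (r i)"])
          fix X assume X: "X \<in> C (r i)"
          then have XP[measurable]: "X \<in> sets P" by (rule C_P)
          have "(\<integral>\<^sup>+x. ennreal (h i x) * indicator X x \<partial>?\<nu>) = (\<integral>\<^sup>+x. indicator (X \<inter> B) x \<partial>?\<nu>)"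
            using elim(1) X by blast
          also have "\<dots> = emeasure ?\<nu> (X \<inter> B)" by simp
          finally show "emeasure (density ?\<nu> (\<lambda>x. ennreal (h i x))) X =
              emeasure (density ?\<nu> (indicator B)) X"
            by (simp add: hd[OF XP] Bd[OF XP])
        next
          have "emeasure (density ?\<nu> (\<lambda>x. ennreal (h i x))) (space P) \<le> (\<integral>\<^sup>+x. 1 \<partial>?\<nu>)"
            unfolding hd[OF sets.top]
            by (intro nn_integral_mono) (use h(3) in \<open>auto simp: indicator_def\<close>)
          also have "\<dots> = 1" by (simp add: \<nu>.emeasure_space_1)
          finally show "emeasure (density ?\<nu> (\<lambda>x. ennreal (h i x)))
              (space (density ?\<nu> (\<lambda>x. ennreal (h i x)))) \<noteq> \<infinity>"
            by (auto simp: sp_\<nu> top_unique)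
        qed (use C(2,4) C_P A[unfolded C(5)] in \<open>auto simp: sets_\<nu> sp_\<nu>\<close>)
        then show ?thesis
          by (simp add: hd Bd in_P[OF A])
      qed
      \<comment> \<open>Since \<open>A\<close> lies in every \<open>G (r i)\<close>, the integrals
        of \<open>h i\<close> over \<open>A\<close> all equal the measure of
        \<open>A \<inter> B\<close>, while dominated convergence takes them to the constant
        \<open>g \<omega>\<close> times the measure of \<open>A\<close>.\<close>
      have AB: "emeasure ?\<nu> (A \<inter> B) = ennreal (g \<omega>) * emeasure ?\<nu> A" if A: "A \<in> sets F" for A
      proof -
        have [measurable]: "A \<in> sets P"
          using A D(1) by (auto simp: subalgebra_def)
        have "(\<lambda>i. \<integral>\<^sup>+x. ennreal (h i x) * indicator A x \<partial>?\<nu>) \<longlonglongrightarrow>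
            (\<integral>\<^sup>+x. ennreal (g \<omega>) * indicator A x \<partial>?\<nu>)"
        proof (rule nn_integral_dominated_convergence[where w = "\<lambda>_. 1"])
          show "AE x in ?\<nu>. (\<lambda>i. ennreal (h i x) * indicator A x) \<longlonglongrightarrow> ennreal (g \<omega>) * indicator A x"
            using elim(2,3)
          proof eventually_elim
            case (elim x)
            then show ?case
              by (cases "x \<in> A") (auto intro: tendsto_ennrealI)
          qed
          show "AE x in ?\<nu>. ennreal (h i x) * indicator A x \<le> 1" for i
            using h(3) by (auto simp: indicator_def)
        qed (auto simp: \<nu>.emeasure_space_1)
        moreover have "A \<in> sets (G (r i))" for i
          using A F by auto
        ultimately have "(\<lambda>i::nat. emeasure ?\<nu> (A \<inter> B)) \<longlonglongrightarrow> ennreal (g \<omega>) * emeasure ?\<nu> A"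
          by (simp add: hG nn_integral_cmult_indicator)
        then show ?thesis
          by (simp add: LIMSEQ_const_iff)
      qed
      \<comment> \<open>The case of the whole space in \<open>AB\<close> identifies the constant,
        which turns \<open>AB\<close> into independence.\<close>
      have "emeasure ?\<nu> B = ennreal (g \<omega>)"
        using AB[OF sets.top] sets.sets_into_space[OF B]
        by (simp add: sp Int_absorb1 \<nu>.emeasure_space_1[unfolded sp_\<nu>])
      then show ?case
        using AB by (simp add: mult.commute)
    qed
  qed
  have "AE \<omega> in ?R. \<forall>B\<in>E. \<forall>A\<in>sets F.
      emeasure (\<mu> \<omega>) (A \<inter> B) = emeasure (\<mu> \<omega>) A * emeasure (\<mu> \<omega>) B"
    using indep E(1) by (simp add: AE_ball_countable)
  then obtain N where N: "N \<in> null_sets ?R"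
    "\<And>\<omega> A B. \<omega> \<in> space P - N \<Longrightarrow> B \<in> E \<Longrightarrow> A \<in> sets F \<Longrightarrow>
      emeasure (\<mu> \<omega>) (A \<inter> B) = emeasure (\<mu> \<omega>) A * emeasure (\<mu> \<omega>) B"
    by (elim AE_E3) (auto simp: space_restr_to_subalg)
  \<comment> \<open>Null sets of the restricted measure belong to \<open>F\<close>, so the
    complement of \<open>N\<close> can serve as the required event.\<close>
  have N': "N \<in> sets F" "N \<in> null_sets P"
    using N(1) by (auto simp: null_sets_restr_to_subalg[OF D(1)])
  have "measure (\<mu> \<omega>) A \<in> {0, 1}" if A: "A \<in> sets F" and \<omega>: "\<omega> \<in> space P - N" for A \<omega>
  proof -
    let ?\<nu> = "\<mu> \<omega>"
    have \<omega>P: "\<omega> \<in> space P" using \<omega> by blast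
    note sets_\<nu>[measurable_cong] = D(3)[OF \<omega>P]
    note sp_\<nu> = D(4)[OF \<omega>P]
    interpret \<nu>: prob_space ?\<nu> by (rule D(2)[OF \<omega>P])
    have AP[measurable]: "A \<in> sets P"
      using A D(1) by (auto simp: subalgebra_def)
    have Ad: "emeasure (density ?\<nu> (indicator A)) X = emeasure ?\<nu> (A \<inter> X)"
      if "X \<in> sets P" for X
      using that by (subst emeasure_density)
        (auto simp: sets_\<nu> simp flip: indicator_inter_arith)
    \<comment> \<open>Independence of \<open>A\<close> from each member of \<open>E\<close> says
      that these two measures agree on \<open>E\<close>, hence on all of \<open>sets P\<close>;
      evaluation at \<open>A\<close> itself gives \<open>p = p * p\<close> for its
      probability.\<close>
    have "emeasure (density ?\<nu> (indicator A)) A = emeasure (scale_measure (emeasure ?\<nu> A) ?\<nu>) A"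
    proof (rule emeasure_eq_on_sigma_sets[where E = E])
      fix X assume X: "X \<in> E"
      then have "X \<in> sets P" using E(3) by blast
      then show "emeasure (density ?\<nu> (indicator A)) X = emeasure (scale_measure (emeasure ?\<nu> A) ?\<nu>) X"
        using N(2)[OF \<omega> X A] by (simp add: Ad)
    next
      show "emeasure (density ?\<nu> (indicator A)) (space (density ?\<nu> (indicator A))) \<noteq> \<infinity>"
        using Ad[OF sets.top] by (simp add: sp_\<nu> less_top)
    qed (use E AP in \<open>auto simp: sets_\<nu> sp_\<nu>\<close>)
    then have "measure ?\<nu> A = measure ?\<nu> A * measure ?\<nu> A"
      by (simp add: Ad \<nu>.emeasure_eq_measure flip: ennreal_mult)
    then show ?thesis by simp
  qed
  moreover have "space P - N \<in> sets F"
    using N'(1) sets.compl_sets[of N F] by (simp add: sp)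
  moreover have "measure P (space P - N) = 1"
    using N'(2) by (simp add: P.prob_compl null_setsD2 measure_eq_0_null_sets)
  ultimately show ?thesis by blast
qed

section \<open>Countable generation of product and invariant fields\<close>

text \<open>The generators are the one-coordinate cylinders over a countable generator of
  \<open>U\<close>. They suffice because measurability of a projection need only be tested on
  generators of its target.\<close>

lemma countably_generated_PiM:
  assumes I: "countable I" and cg: "countably_generated U"
  shows "countably_generated (\<Pi>\<^sub>M i\<in>I. U)"
proof -
  obtain C where C: "countable C" "C \<subseteq> sets U" "sets U = sigma_sets (space U) C"
    using cg unfolding countably_generated_def by blast
  let ?\<Omega> = "space (\<Pi>\<^sub>M i\<in>I. U)"
  define E where "E = (\<lambda>(i, A). {f \<in> ?\<Omega>. f i \<in> A}) ` (I \<times> C)"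
  have E_sub: "E \<subseteq> sets (\<Pi>\<^sub>M i\<in>I. U)"
    unfolding E_def using C(2) by (auto intro!: sets_Collect_single')
  then have E_Pow: "E \<subseteq> Pow ?\<Omega>"
    using sets.sets_into_space by blast
  have proj: "(\<lambda>f. f i) \<in> sigma ?\<Omega> E \<rightarrow>\<^sub>M U" if i: "i \<in> I" for i
  proof (rule measurable_sigma_sets[OF C(3)])
    show "C \<subseteq> Pow (space U)"
      using C(2) sets.sets_into_space by blast
    show "(\<lambda>f. f i) \<in> space (sigma ?\<Omega> E) \<rightarrow> space U"
      using i by (auto simp: space_measure_of_conv space_PiM)
    fix A assume "A \<in> C"
    then have "{f \<in> ?\<Omega>. f i \<in> A} \<in> E"
      using i unfolding E_def by auto
    moreover have "(\<lambda>f. f i) -` A \<inter> space (sigma ?\<Omega> E) = {f \<in> ?\<Omega>. f i \<in> A}"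
      by (auto simp: space_measure_of_conv)
    ultimately show "(\<lambda>f. f i) -` A \<inter> space (sigma ?\<Omega> E) \<in> sets (sigma ?\<Omega> E)"
      using E_Pow by auto
  qed
  have "sets (\<Pi>\<^sub>M i\<in>I. U) \<subseteq> sigma_sets ?\<Omega> E"
    unfolding sets_PiM_single
    unfolding space_PiM[symmetric]
  proof (rule sigma_sets_mono, clarify)
    fix i A assume iA: "i \<in> I" "A \<in> sets U"
    have "(\<lambda>f. f i) -` A \<inter> space (sigma ?\<Omega> E) \<in> sets (sigma ?\<Omega> E)"
      by (rule measurable_sets[OF proj[OF iA(1)] iA(2)])
    moreover have "(\<lambda>f. f i) -` A \<inter> space (sigma ?\<Omega> E) = {f \<in> ?\<Omega>. f i \<in> A}"
      by (auto simp: space_measure_of_conv)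
    ultimately show "{f \<in> ?\<Omega>. f i \<in> A} \<in> sigma_sets ?\<Omega> E"
      using E_Pow by simp
  qed
  then have "sets (\<Pi>\<^sub>M i\<in>I. U) = sigma_sets ?\<Omega> E"
    using sets.sigma_sets_subset[OF E_sub] by blast
  moreover have "countable E"
    unfolding E_def using I C(1) by auto
  ultimately show ?thesis
    unfolding countably_generated_def using E_sub by blast
qed

text \<open>Invariant events are produced by symmetrisation: \<open>S C x\<close> counts the maps in
  \<open>T\<close> that take \<open>x\<close> into \<open>C\<close>, and is an invariant function of
  \<open>x\<close>. A finite set of surjections closed under composition behaves like a group
  here.\<close>

lemma countably_generated_invariant_sets:
  assumes cg: "countably_generated M" and T: "finite T" "T \<noteq> {}" "T \<subseteq> M \<rightarrow>\<^sub>M M"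
    and comp: "\<And>s t. s \<in> T \<Longrightarrow> t \<in> T \<Longrightarrow> t \<circ> s \<in> T" and surj: "\<And>s. s \<in> T \<Longrightarrow> surj s"
  obtains H where "space H = space M"
    "sets H = {B \<in> sets M. \<forall>t\<in>T. t -` B \<inter> space M = B}" "countably_generated H"
proof -
  obtain E where E: "countable E" "Int_stable E" "E \<subseteq> sets M" "space M \<in> E"
      "sets M = sigma_sets (space M) E"
    using countably_generated_Int_stable[OF cg] by blast
  let ?inv = "{B \<in> sets M. \<forall>t\<in>T. t -` B \<inter> space M = B}"
  define S :: "'a set \<Rightarrow> 'a \<Rightarrow> real" where "S C x = (\<Sum>t\<in>T. indicator C (t x))" for C x
  have S_card: "S C x = real (card {t \<in> T. t x \<in> C})" for C x
    using T(1) unfolding S_def indicator_def of_bool_def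
    by (simp add: sum.If_cases Int_def)
  have S_M: "S C \<in> borel_measurable M" if "C \<in> sets M" for C
    unfolding S_def
  proof (rule borel_measurable_sum)
    fix t assume "t \<in> T"
    then have "t \<in> M \<rightarrow>\<^sub>M M" using T(3) by blast
    then show "(\<lambda>x. indicator C (t x)) \<in> borel_measurable M"
      using that by (rule measurable_compose[OF _ borel_measurable_indicator])
  qed
  \<comment> \<open>Composing on the right with the surjection \<open>s\<close> is injective on the
    finite set \<open>T\<close>, so it permutes \<open>T\<close> and merely reindexes the
    sum.\<close>
  have S_inv: "S C (s x) = S C x" if s: "s \<in> T" for C s x
  proof -
    have inj: "inj_on (\<lambda>t. t \<circ> s) T"
      using surj[OF s] by (intro inj_onI) (metis fun.map_comp surj_fun_eq comp_apply ext surj_f_inv_f)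
    have "(\<lambda>t. t \<circ> s) ` T = T"
      using comp[OF s] by (intro endo_inj_surj T(1) inj) blast
    then have "S C x = (\<Sum>t\<in>(\<lambda>t. t \<circ> s) ` T. indicator C (t x))"
      unfolding S_def by simp
    also have "\<dots> = S C (s x)"
      unfolding S_def by (simp add: sum.reindex[OF inj])
    finally show ?thesis by simp
  qed
  have T_sp: "t x \<in> space M" if "t \<in> T" "x \<in> space M" for t x
    using that T(3) by (meson measurable_space subsetD)
  \<comment> \<open>Since \<open>S C\<close> takes values in the natural numbers, its level sets at
    naturals determine its measurability; letting \<open>C\<close> range over \<open>E\<close> keeps
    the family countable.\<close>
  define K where "K = (\<lambda>(C, i::nat). {x \<in> space M. S C x = real i}) ` (E \<times> UNIV)"
  define H where "H = sigma (space M) K"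
  have K_inv: "K \<subseteq> ?inv"
  proof
    fix X assume "X \<in> K"
    then obtain C i where X: "C \<in> E" "X = {x \<in> space M. S C x = real i}"
      unfolding K_def by auto
    have "X \<in> sets M"
      using S_M[of C] X E(3) by auto
    moreover have "t -` X \<inter> space M = X" if "t \<in> T" for t
      using that S_inv T_sp by (auto simp: X(2))
    ultimately show "X \<in> ?inv" by simp
  qed
  then have K_Pow: "K \<subseteq> Pow (space M)"
    using sets.sets_into_space by blast
  have E_Pow: "E \<subseteq> Pow (space M)"
    using E(3) sets.sets_into_space by blast
  have H: "space H = space M" "sets H = sigma_sets (space M) K"
    using K_Pow by (simp_all add: H_def)
  have H_inv: "B \<in> ?inv" if "B \<in> sigma_sets (space M) K" for B
    using that
  proof induction
    case (Basic X)
    then show ?case using K_inv by blast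
  next
    case Empty
    then show ?case by simp
  next
    case (Compl X)
    then show ?case using T_sp by blast
  next
    case (Union X)
    then have "(\<Union>i. X i) \<in> sets M" by blast
    moreover have "t -` (\<Union>i. X i) \<inter> space M = (\<Union>i. X i)" if "t \<in> T" for t
      using Union that by blast
    ultimately show ?case by blast
  qed
  \<comment> \<open>\<open>S C\<close> is \<open>H\<close>-measurable for all \<open>C\<close> by Dynkin's lemma, and an invariant \<open>B\<close> is the set \<open>S B > 0\<close>.\<close>
  have inv_H: "B \<in> sets H" if B: "B \<in> ?inv" for B
  proof -
    have "S C \<in> borel_measurable H" if "C \<in> sigma_sets (space M) E" for C
      using E(2) E_Pow that
    proof (induction rule: sigma_sets_induct_disjoint)
      case (basic C)
      have "(\<lambda>x. card {t \<in> T. t x \<in> C}) \<in> H \<rightarrow>\<^sub>M count_space UNIV"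
      proof (subst measurable_count_space_eq_countable, simp, intro conjI ballI)
        fix i :: nat
        have "(\<lambda>x. card {t \<in> T. t x \<in> C}) -` {i} \<inter> space H = {x \<in> space M. S C x = real i}"
          by (auto simp: S_card H)
        also have "\<dots> \<in> K"
          using basic unfolding K_def by auto
        finally show "(\<lambda>x. card {t \<in> T. t x \<in> C}) -` {i} \<inter> space H \<in> sets H"
          by (simp add: H sigma_sets.Basic)
      qed simp
      then have "(\<lambda>x. real (card {t \<in> T. t x \<in> C})) \<in> borel_measurable H"
        by (rule measurable_compose) simp
      then show ?case
        by (simp add: S_card[abs_def])
    next
      case empty
      then show ?case by (simp add: S_def[abs_def])
    next
      case (compl C)
      have "S (space M - C) x = real (card T) - S C x" if "x \<in> space H" for x
      proof -
        have "S (space M - C) x = (\<Sum>t\<in>T. 1 - indicator C (t x))"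
          unfolding S_def using that T_sp
          by (intro sum.cong) (auto simp: H indicator_def)
        then show ?thesis by (simp add: sum_subtractf S_def)
      qed
      moreover have "(\<lambda>x. real (card T) - S C x) \<in> borel_measurable H"
        using compl by simp
      ultimately show ?case
        by (simp cong: measurable_cong)
    next
      case (union C)
      have "(\<lambda>i. S (C i) x) sums S (\<Union>i. C i) x" for x
        unfolding S_def using union(1)
        by (intro sums_sum indicator_sums) (auto simp: disjoint_family_on_def)
      then have "S (\<Union>i. C i) = (\<lambda>x. \<Sum>i. S (C i) x)"
        by (intro ext) (simp add: sums_iff)
      moreover have "(\<lambda>x. \<Sum>i. S (C i) x) \<in> borel_measurable H"
        using union by (intro borel_measurable_suminf) simp
      ultimately show ?case by simp
    qed
    then have "{x \<in> space H. 0 < S B x} \<in> sets H"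
      using B E(5) by simp
    moreover have "{x \<in> space H. 0 < S B x} = B"
    proof -
      have "t x \<in> B \<longleftrightarrow> x \<in> B" if "x \<in> space M" "t \<in> T" for t x
        using B that by blast
      then have "{t \<in> T. t x \<in> B} = (if x \<in> B then T else {})" if "x \<in> space M" for x
        using that by auto
      then have "0 < S B x \<longleftrightarrow> x \<in> B" if "x \<in> space M" for x
        using that T(1,2) by (simp add: S_card card_gt_0_iff)
      moreover have "B \<subseteq> space M"
        using B sets.sets_into_space by blast
      ultimately show ?thesis
        by (auto simp: H)
    qed
    ultimately show ?thesis by simp
  qed
  have sets_H: "sets H = ?inv"
    using H_inv unfolding H(2)[symmetric] by (intro equalityI subsetI inv_H)
  have "countably_generated H"
  proof -
    have "countable K"
      unfolding K_def using E(1) by auto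
    moreover have "K \<subseteq> sets H"
      by (simp add: H sigma_sets_superset_generator)
    ultimately show ?thesis
      unfolding countably_generated_def using H by metis
  qed
  with H(1) sets_H show thesis
    by (rule that)
qed

section \<open>The groups of coordinate permutations\<close>

lemma finite_coord_perms: "finite (coord_perms n)"
  unfolding coord_perms_def by (intro finite_image_set finite_permutations) simp

lemma coord_perms_nonempty: "coord_perms n \<noteq> {}"
  unfolding coord_perms_def using permutes_id by blast

lemma coord_perms_measurable: "coord_perms n \<subseteq> seq_space U \<rightarrow>\<^sub>M seq_space U"
  unfolding coord_perms_def
  by (auto intro!: measurable_PiM_single' simp: space_PiM PiE_iff)

lemma coord_perms_comp:
  assumes "s \<in> coord_perms n" "t \<in> coord_perms n"
  shows "t \<circ> s \<in> coord_perms n"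
proof -
  obtain \<sigma> \<tau> where "\<sigma> permutes {..<n}" "s = (\<lambda>\<omega> i. \<omega> (\<sigma> i))"
      "\<tau> permutes {..<n}" "t = (\<lambda>\<omega> i. \<omega> (\<tau> i))"
    using assms unfolding coord_perms_def by blast
  \<comment> \<open>Permutations act on indices, so the order of composition is reversed.\<close>
  moreover from this have "\<sigma> \<circ> \<tau> permutes {..<n}"
    by (intro permutes_compose)
  ultimately show ?thesis
    unfolding coord_perms_def by (intro CollectI exI[of _ "\<sigma> \<circ> \<tau>"]) auto
qed

lemma coord_perms_surj:
  assumes "s \<in> coord_perms n"
  shows "surj s"
proof -
  obtain \<sigma> where "\<sigma> permutes {..<n}" "s = (\<lambda>\<omega> i. \<omega> (\<sigma> i))"
    using assms unfolding coord_perms_def by blast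
  then show ?thesis
    by (intro surjI[of s "\<lambda>\<omega>. \<omega> \<circ> inv \<sigma>"]) (simp add: permutes_inverses)
qed

text \<open>More maps leave fewer sets invariant, which makes the fields \<open>G n\<close>
  decrease.\<close>

lemma coord_perms_mono:
  assumes "m \<le> n"
  shows "coord_perms m \<subseteq> coord_perms n"
proof -
  have "\<pi> permutes {..<n}" if "\<pi> permutes {..<m}" for \<pi>
    using permutes_subset[OF that, of "{..<n}"] assms by auto
  then show ?thesis
    unfolding coord_perms_def by blast
qed

section \<open>The zero-one law for the symmetric field\<close>

theorem mainTheorem2:
  fixes U :: "'a measure"
    and P :: "(nat \<Rightarrow> 'a) measure"
    and \<mu> :: "(nat \<Rightarrow> 'a) \<Rightarrow> (nat \<Rightarrow> 'a) measure"
  assumes "countably_generated U"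
    and "sets P = sets (seq_space U)"
    and "prob_space P"
    and "perfect_measure P"
    and "regular_cond_distribution P (symmetric_field U) \<mu>"
  shows "\<exists>A\<^sub>0 \<in> sets (symmetric_field U).
           measure P A\<^sub>0 = 1 \<and>
           (\<forall>A \<in> sets (symmetric_field U). \<forall>\<omega> \<in> A\<^sub>0. measure (\<mu> \<omega>) A \<in> {0, 1})"
proof -
  let ?M = "seq_space U"
  let ?inv = "\<lambda>n. {B \<in> sets ?M. \<forall>t\<in>coord_perms n. t -` B \<inter> space ?M = B}"
  have sp: "space P = space ?M"
    using assms(2) by (rule sets_eq_imp_space_eq)
  have cg: "countably_generated ?M"
    by (intro countably_generated_PiM assms(1)) simp
  \<comment> \<open>The shift to \<open>Suc n\<close> matches the union over orders at least one in
    \<open>symmetric_sets\<close>, so that the intersection over all naturals is exactly the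
    symmetric field.\<close>
  have "\<exists>H. space H = space ?M \<and> sets H = ?inv (Suc n) \<and> countably_generated H" for n
  proof (rule countably_generated_invariant_sets[OF cg finite_coord_perms coord_perms_nonempty
        coord_perms_measurable, of "Suc n"])
    show "t \<circ> s \<in> coord_perms (Suc n)"
      if "s \<in> coord_perms (Suc n)" "t \<in> coord_perms (Suc n)" for s t :: "(nat \<Rightarrow> 'a) \<Rightarrow> nat \<Rightarrow> 'a"
      using that by (rule coord_perms_comp)
    show "surj s" if "s \<in> coord_perms (Suc n)" for s :: "(nat \<Rightarrow> 'a) \<Rightarrow> nat \<Rightarrow> 'a"
      using that by (rule coord_perms_surj)
  qed blast
  then obtain G where G: "\<And>n. space (G n) = space ?M" "\<And>n. sets (G n) = ?inv (Suc n)"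
      "\<And>n. countably_generated (G n)"
    by metis
  show ?thesis
  proof (rule regular_cond_distribution_zero_one_decreasing[where G = G])
    show "countably_generated P"
      using cg by (simp add: countably_generated_def assms(2) sp)
    show "subalgebra P (G n)" for n
      unfolding subalgebra_def G assms(2) sp by blast
    show "sets (G (Suc n)) \<subseteq> sets (G n)" for n
    proof -
      have "(coord_perms (Suc n) :: ((nat \<Rightarrow> 'a) \<Rightarrow> nat \<Rightarrow> 'a) set) \<subseteq> coord_perms (Suc (Suc n))"
        by (rule coord_perms_mono) simp
      then show ?thesis
        unfolding G by auto
    qed
    have "{1..} = range Suc"
      by (simp add: atLeast_Suc_greaterThan greaterThan_0)
    then show "sets (symmetric_field U) = (\<Inter>n. sets (G n))"
      unfolding sets_symmetric_field symmetric_sets_def G by (intro set_eqI) simp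
  qed (use assms G in auto)
qed

end
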